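(* Let $p\in\mathbb{N}$ and let $\alpha,\beta$ be positive irrational numbers with $\alpha\le\beta$ and $\alpha^{-1}+\beta^{-1}=p$. Put $M=\lfloor 1/\alpha\rfloor+1$ and $N=\lfloor 1/\beta\rfloor+1$, and let $S$ be the multiset $\{\lfloor n\alpha\rfloor\}_{n\ge M}$ and $T$ the multiset $\{\lfloor n\beta\rfloor\}_{n\ge N}$. Then $S$ and $T$ are $p$-fold complementary: the multiset union $S\cup T$ equals $p\times\mathbb{N}$, i.e. every positive integer occurs exactly $p$ times in total in $S$ and $T$, and no other integers occur.
   Context: $\mathbb{N}=\{1,2,\dots\}$; $p\times\mathbb{N}$ denotes the multiset in which every positive integer has multiplicity $p$. *)

theory Defs
  imports Complex_Main "HOL-Library.Extended_Nat"
begin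

text \<open>The library's type of multisets is restricted to finite ones, so a possibly
  infinite multiset is represented by its multiplicity function.  Multiplicities are
  extended naturals: an element that is repeated infinitely often has multiplicity
  \<infinity>, whereas the library's cardinality of an infinite set would be 0.\<close>

type_synonym 'a inf_mset = "'a \<Rightarrow> enat"

definition family_mset :: "'i set \<Rightarrow> ('i \<Rightarrow> 'a) \<Rightarrow> 'a inf_mset" where
  "family_mset I f = (\<lambda>x. let F = {i \<in> I. f i = x} in if finite F then enat (card F) else \<infinity>)"

text \<open>This is the union in which multiplicities are added, not the one in which the maximum is taken.\<close>

definition inf_mset_union :: "'a inf_mset \<Rightarrow> 'a inf_mset \<Rightarrow> 'a inf_mset" where
  "inf_mset_union S T = (\<lambda>x. S x + T x)"

definition copies :: "nat \<Rightarrow> 'a set \<Rightarrow> 'a inf_mset" where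
  "copies p A = (\<lambda>x. if x \<in> A then enat p else 0)"

definition fold_complementary :: "nat \<Rightarrow> int inf_mset \<Rightarrow> int inf_mset \<Rightarrow> bool" where
  "fold_complementary p S T \<longleftrightarrow> inf_mset_union S T = copies p {1..}"

end

theory Submission
  imports Defs
begin

text \<open>For \<open>k \<ge> 1\<close> the indices \<open>n\<close> with \<open>\<lfloor>n\<alpha>\<rfloor> = k\<close> form the interval \<open>(\<lfloor>k/\<alpha>\<rfloor>, \<lfloor>(k+1)/\<alpha>\<rfloor>]\<close>,
  since \<open>k/\<alpha>\<close> and \<open>(k+1)/\<alpha>\<close> are not integers. The numbers \<open>k/\<alpha>\<close> and \<open>k/\<beta>\<close> are irrational with
  integer sum \<open>kp\<close>, so their floors add up to \<open>kp - 1\<close>; subtracting this identity for \<open>k\<close>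
  from that for \<open>k + 1\<close> gives the total multiplicity \<open>p\<close>.\<close>

lemma divide_irrational_not_Ints:
  fixes \<alpha> :: real
  assumes "\<alpha> \<notin> \<rat>" and "k \<noteq> 0"
  shows "of_int k / \<alpha> \<notin> \<int>"
proof
  assume "of_int k / \<alpha> \<in> \<int>"
  then obtain m where m: "of_int k / \<alpha> = of_int m"
    by (elim Ints_cases)
  have "\<alpha> \<noteq> 0"
    using assms(1) by auto
  with m assms(2) have "\<alpha> = of_int k / of_int m"
    by (auto simp: field_simps)
  with assms(1) show False
    by simp
qed

lemma le_of_int_iff_floor_less:
  fixes x :: real
  assumes "x \<notin> \<int>"
  shows "x \<le> of_int n \<longleftrightarrow> \<lfloor>x\<rfloor> < n"
proof -
  have "x \<noteq> of_int n"
    using assms by auto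
  then show ?thesis
    by (auto simp: floor_less_iff)
qed

text \<open>Since \<open>y = m - x\<close>, its floor is \<open>m\<close> minus the ceiling of
  \<open>x\<close>, and the ceiling of a non-integer is its floor plus one.\<close>

lemma floor_add_eq_of_sum_eq_of_int:
  fixes x y :: real
  assumes "x \<notin> \<int>" and "x + y = of_int m"
  shows "\<lfloor>x\<rfloor> + \<lfloor>y\<rfloor> = m - 1"
proof -
  have "y = of_int m - x"
    using assms(2) by simp
  moreover have "of_int \<lfloor>x\<rfloor> \<noteq> x"
    using assms(1) by (metis Ints_of_int)
  then have "of_int \<lfloor>x\<rfloor> < x"
    using of_int_floor_le[of x] by linarith
  then have "\<lfloor>of_int m - x\<rfloor> = m - 1 - \<lfloor>x\<rfloor>"
    by (intro floor_unique) (simp_all, linarith)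
  ultimately show ?thesis
    by simp
qed

text \<open>Divide by \<alpha> and round both endpoints down. The bound \<open>k \<ge> 1\<close>
  matters: for \<open>k = 0\<close> the left endpoint is the integer 0, and the solution
  \<open>n = 0\<close> would be lost.\<close>

lemma floor_mult_eq_iff:
  fixes \<alpha> :: real
  assumes "\<alpha> > 0" and "\<alpha> \<notin> \<rat>" and "k \<ge> 1"
  shows "\<lfloor>of_int n * \<alpha>\<rfloor> = k \<longleftrightarrow> \<lfloor>of_int k / \<alpha>\<rfloor> < n \<and> n \<le> \<lfloor>of_int (k + 1) / \<alpha>\<rfloor>"
proof -
  have "\<lfloor>of_int n * \<alpha>\<rfloor> = k \<longleftrightarrow> of_int k / \<alpha> \<le> of_int n \<and> of_int n < of_int (k + 1) / \<alpha>"
    using assms(1) by (simp add: floor_eq_iff field_simps)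
  also have "of_int k / \<alpha> \<le> of_int n \<longleftrightarrow> \<lfloor>of_int k / \<alpha>\<rfloor> < n"
    using assms by (intro le_of_int_iff_floor_less divide_irrational_not_Ints) auto
  \<comment> \<open>This is the negated form of \<open>le_of_int_iff_floor_less\<close>, taken at
    the non-integer \<open>(k + 1) / \<alpha>\<close>.\<close>
  also have "of_int n < of_int (k + 1) / \<alpha> \<longleftrightarrow> n \<le> \<lfloor>of_int (k + 1) / \<alpha>\<rfloor>"
    using assms le_of_int_iff_floor_less[OF divide_irrational_not_Ints, of \<alpha> "k + 1" n] by linarith
  finally show ?thesis .
qed

text \<open>The starting index is the least \<open>n\<close> with \<open>n > 1 / \<alpha>\<close>,
  so it discards all indices with values below 1 and none with a positive value.\<close>

lemma family_mset_floor_mult: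
  fixes \<alpha> :: real
  assumes "\<alpha> > 0" and "\<alpha> \<notin> \<rat>"
  shows "family_mset {\<lfloor>1 / \<alpha>\<rfloor> + 1..} (\<lambda>n. \<lfloor>of_int n * \<alpha>\<rfloor>) k =
    (if k \<ge> 1 then enat (nat (\<lfloor>of_int (k + 1) / \<alpha>\<rfloor> - \<lfloor>of_int k / \<alpha>\<rfloor>)) else 0)"
proof (cases "k \<ge> 1")
  case True
  \<comment> \<open>The whole interval of solutions lies at or beyond the starting index, so the
    restriction removes none of it.\<close>
  have "\<lfloor>1 / \<alpha>\<rfloor> \<le> \<lfloor>of_int k / \<alpha>\<rfloor>"
    using True assms(1) by (intro floor_mono divide_right_mono) auto
  then have "{n \<in> {\<lfloor>1 / \<alpha>\<rfloor> + 1..}. \<lfloor>of_int n * \<alpha>\<rfloor> = k} = {\<lfloor>of_int k / \<alpha>\<rfloor><..\<lfloor>of_int (k + 1) / \<alpha>\<rfloor>}"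
    unfolding floor_mult_eq_iff[OF assms True] by auto
  then show ?thesis
    using True by (simp add: family_mset_def)
next
  case False
  have "\<lfloor>of_int n * \<alpha>\<rfloor> \<ge> 1" if "n \<ge> \<lfloor>1 / \<alpha>\<rfloor> + 1" for n
  proof -
    have "1 / \<alpha> < of_int n"
      using that by linarith
    then show ?thesis
      using assms(1) by (simp add: field_simps)
  qed
  then have "{n \<in> {\<lfloor>1 / \<alpha>\<rfloor> + 1..}. \<lfloor>of_int n * \<alpha>\<rfloor> = k} = {}"
    using False by fastforce
  then show ?thesis
    using False by (simp only: family_mset_def) (simp flip: zero_enat_def)
qed

theorem theorem1:
  fixes p :: nat and \<alpha> \<beta> :: real and M N :: int and S T :: "int inf_mset"
  assumes "p \<ge> 1"
    and "\<alpha> > 0" and "\<beta> > 0"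
    and "\<alpha> \<notin> \<rat>" and "\<beta> \<notin> \<rat>"
    and "\<alpha> \<le> \<beta>"
    and "inverse \<alpha> + inverse \<beta> = real p"
    and "M = \<lfloor>1 / \<alpha>\<rfloor> + 1" and "N = \<lfloor>1 / \<beta>\<rfloor> + 1"
    and "S = family_mset {M..} (\<lambda>n. \<lfloor>of_int n * \<alpha>\<rfloor>)"
    and "T = family_mset {N..} (\<lambda>n. \<lfloor>of_int n * \<beta>\<rfloor>)"
  shows "fold_complementary p S T"
proof -
  have floors: "\<lfloor>of_int k / \<alpha>\<rfloor> + \<lfloor>of_int k / \<beta>\<rfloor> = k * int p - 1" if "k \<ge> 1" for k
  proof (rule floor_add_eq_of_sum_eq_of_int)
    show "of_int k / \<alpha> \<notin> \<int>"
      using that assms(4) by (intro divide_irrational_not_Ints) auto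
    have "of_int k / \<alpha> + of_int k / \<beta> = of_int k * (inverse \<alpha> + inverse \<beta>)"
      by (simp add: divide_inverse distrib_left)
    then show "of_int k / \<alpha> + of_int k / \<beta> = of_int (k * int p)"
      unfolding assms(7) by simp
  qed
  have "S k + T k = copies p {1..} k" for k
  proof (cases "k \<ge> 1")
    case True
    let ?a = "\<lfloor>of_int (k + 1) / \<alpha>\<rfloor> - \<lfloor>of_int k / \<alpha>\<rfloor>"
    let ?b = "\<lfloor>of_int (k + 1) / \<beta>\<rfloor> - \<lfloor>of_int k / \<beta>\<rfloor>"
    \<comment> \<open>\<open>nat\<close> sends negative integers to 0, so the signs are needed to
      carry the sum over to \<open>nat\<close>.\<close>
    have "?a \<ge> 0" "?b \<ge> 0"
      using assms(2,3) by (auto intro!: floor_mono divide_right_mono)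
    moreover have "?a + ?b = int p"
      using floors[of k] floors[of "k + 1"] True by (simp add: distrib_right)
    ultimately have "nat ?a + nat ?b = p"
      by linarith
    then show ?thesis
      unfolding assms(8-11) family_mset_floor_mult[OF assms(2,4)] family_mset_floor_mult[OF assms(3,5)]
      using True by (simp add: copies_def)
  next
    case False
    then show ?thesis
      unfolding assms(8-11) family_mset_floor_mult[OF assms(2,4)] family_mset_floor_mult[OF assms(3,5)]
      by (simp add: copies_def)
  qed
  then show ?thesis
    by (auto simp: fold_complementary_def inf_mset_union_def)
qed

end
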